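(* Let $\lambda$ be an invariant subgroup measure in a locally compact, second countable group $G$, i.e. a $\sigma$-finite Borel measure on $\mathrm{Sub}_G$ that is invariant under the conjugation action of $G$. Then the following are equivalent. (1) There exists a left $G$-invariant $\sigma$-finite Borel measure $\nu$ on $\mathrm{Cos}_G$ such that $\pi_{l*}(\nu)\equiv\pi_{r*}(\nu)\equiv\lambda$ and $\rho_*\nu=\nu$. (2) There exists a $\sigma$-finite Borel measure $\nu$ on $\mathrm{Cos}_G$, invariant under both the left and right actions of $G$, such that $\pi_{l*}(\nu)\equiv\pi_{r*}(\nu)\equiv\lambda$ (that is, $\lambda$ is co-unimodular).
   Context: Topological groups are Hausdorff. $\mathrm{Sub}_G$ is the space of closed subgroups of $G$ with the Chabauty topology, on which $G$ acts by conjugation $H\mapsto kHk^{-1}$. $\mathrm{Cos}_G=\{gH: g\in G,\ H\in\mathrm{Sub}_G\}=\{Hg: g\in G,\ H\in\mathrm{Sub}_G\}$ is the space of cosets of closed subgroups of $G$ (note $gH=(gHg^{-1})g$), with the Fell topology of closed subsets of $G$, i.e. the topology with subbasis $\{C:C\cap K=\emptyset\}$ ($K\subset G$ compact) and $\{C:C\cap U\ne\emptyset\}$ ($U\subset G$ open). $G$ acts on $\mathrm{Cos}_G$ by left multiplication $C\mapsto kC$ and by right multiplication $C\mapsto Ck$. The maps $\pi_l,\pi_r:\mathrm{Cos}_G\to\mathrm{Sub}_G$ are $\pi_l(gH)=H$ and $\pi_r(Hg)=H$. The involution $\rho:\mathrm{Cos}_G\to\mathrm{Cos}_G$ is $\rho(Hg)=g^{-1}H$.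 The symbol $\equiv$ denotes equivalence of measures, i.e. having the same null sets. *)

theory Defs
  imports "HOL-Analysis.Analysis" "HOL-Algebra.Coset"
begin

locale topological_group = group G for G (structure) +
  fixes T :: "'a topology"
  assumes topspace_eq: "topspace T = carrier G"
    and Hausdorff: "Hausdorff_space T"
    and continuous_mult: "continuous_map (prod_topology T T) T (\<lambda>(x, y). x \<otimes> y)"
    and continuous_inv: "continuous_map T T (\<lambda>x. inv x)"

text \<open>Taking \<open>K = {}\<close> shows that the underlying set is the set of all closed subsets.\<close>

definition fell_topology :: "'a topology \<Rightarrow> 'a set topology" where
  "fell_topology T = topology_generated_by
     ({{C. closedin T C \<and> C \<inter> K = {}} |K. compactin T K} \<union>
      {{C. closedin T C \<and> C \<inter> U \<noteq> {}} |U. openin T U})"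

definition closed_subgroups :: "('a, 'b) monoid_scheme \<Rightarrow> 'a topology \<Rightarrow> 'a set set" where
  "closed_subgroups G T = {H. subgroup H G \<and> closedin T H}"

definition closed_cosets :: "('a, 'b) monoid_scheme \<Rightarrow> 'a topology \<Rightarrow> 'a set set" where
  "closed_cosets G T = {g <#\<^bsub>G\<^esub> H |g H. g \<in> carrier G \<and> H \<in> closed_subgroups G T}"

definition Sub_space :: "('a, 'b) monoid_scheme \<Rightarrow> 'a topology \<Rightarrow> 'a set topology" where
  "Sub_space G T = subtopology (fell_topology T) (closed_subgroups G T)"

definition Cos_space :: "('a, 'b) monoid_scheme \<Rightarrow> 'a topology \<Rightarrow> 'a set topology" where
  "Cos_space G T = subtopology (fell_topology T) (closed_cosets G T)"

text \<open>The three maps below are meaningful on \<open>closed_cosets G T\<close> only; see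
  \<open>pi_l_eq\<close>, \<open>pi_r_eq\<close>, \<open>coset_inversion_eq\<close> and \<open>closed_cosets_eq_right\<close> for well-definedness.\<close>

definition pi_l :: "('a, 'b) monoid_scheme \<Rightarrow> 'a topology \<Rightarrow> 'a set \<Rightarrow> 'a set" where
  "pi_l G T C = (THE H. H \<in> closed_subgroups G T \<and> (\<exists>g\<in>carrier G. C = g <#\<^bsub>G\<^esub> H))"

definition pi_r :: "('a, 'b) monoid_scheme \<Rightarrow> 'a topology \<Rightarrow> 'a set \<Rightarrow> 'a set" where
  "pi_r G T C = (THE H. H \<in> closed_subgroups G T \<and> (\<exists>g\<in>carrier G. C = H #>\<^bsub>G\<^esub> g))"

definition coset_inversion :: "('a, 'b) monoid_scheme \<Rightarrow> 'a topology \<Rightarrow> 'a set \<Rightarrow> 'a set" where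
  "coset_inversion G T C =
     (THE D. \<exists>g\<in>carrier G. \<exists>H\<in>closed_subgroups G T.
        C = H #>\<^bsub>G\<^esub> g \<and> D = inv\<^bsub>G\<^esub> g <#\<^bsub>G\<^esub> H)"

definition borel_of :: "'a topology \<Rightarrow> 'a measure" where
  "borel_of X = sigma (topspace X) {U. openin X U}"

definition sigma_finite_borel_measure :: "'a topology \<Rightarrow> 'a measure \<Rightarrow> bool" where
  "sigma_finite_borel_measure X M \<longleftrightarrow> sets M = sets (borel_of X) \<and> sigma_finite_measure M"

definition equivalent_measures :: "'a measure \<Rightarrow> 'a measure \<Rightarrow> bool" where
  "equivalent_measures M N \<longleftrightarrow> sets M = sets N \<and> null_sets M = null_sets N"

text \<open>\<open>distr\<close> is a genuine push-forward only for measurable maps. The maps it is applied to here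
  are continuous for the Fell topology: translations, conjugations and \<open>coset_inversion\<close> are
  homeomorphisms, and if \<open>T\<close> is locally compact, then \<open>pi_l\<close> and \<open>pi_r\<close> are continuous.\<close>

definition invariant_subgroup_measure ::
  "('a, 'b) monoid_scheme \<Rightarrow> 'a topology \<Rightarrow> 'a set measure \<Rightarrow> bool" where
  "invariant_subgroup_measure G T L \<longleftrightarrow>
     sigma_finite_borel_measure (Sub_space G T) L \<and>
     (\<forall>k\<in>carrier G. distr L L (\<lambda>H. k <#\<^bsub>G\<^esub> H #>\<^bsub>G\<^esub> inv\<^bsub>G\<^esub> k) = L)"

definition left_invariant :: "('a, 'b) monoid_scheme \<Rightarrow> 'a set measure \<Rightarrow> bool" where
  "left_invariant G N \<longleftrightarrow> (\<forall>k\<in>carrier G. distr N N (\<lambda>C. k <#\<^bsub>G\<^esub> C) = N)"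

definition right_invariant :: "('a, 'b) monoid_scheme \<Rightarrow> 'a set measure \<Rightarrow> bool" where
  "right_invariant G N \<longleftrightarrow> (\<forall>k\<in>carrier G. distr N N (\<lambda>C. C #>\<^bsub>G\<^esub> k) = N)"

lemma topspace_fell: "topspace (fell_topology T) = {C. closedin T C}"
  unfolding fell_topology_def topology_generated_by_topspace
  by (auto intro!: exI[of _ "{C. closedin T C}"] exI[of _ "{}"])

context topological_group
begin

lemma cancel_inv:
  assumes "g \<in> carrier G" "x \<in> carrier G"
  shows "inv g \<otimes> (g \<otimes> x) = x" "g \<otimes> (inv g \<otimes> x) = x"
  using assms by (simp_all flip: m_assoc)

lemma conjugate_closed_subgroup:
  assumes g: "g \<in> carrier G" and H: "H \<in> closed_subgroups G T"
  shows "g <# H #> inv g \<in> closed_subgroups G T"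
proof -
  have sub: "subgroup H G" and cl: "closedin T H"
    using H by (auto simp: closed_subgroups_def)
  have HG: "H \<subseteq> carrier G"
    by (rule subgroup.subset[OF sub])
  have eq: "g <# H #> inv g = {x \<in> topspace T. inv g \<otimes> x \<otimes> g \<in> H}" (is "?A = ?B")
  proof (intro equalityI subsetI)
    fix x assume "x \<in> ?A"
    then obtain h where h: "h \<in> H" "x = g \<otimes> h \<otimes> inv g"
      by (auto simp: l_coset_def r_coset_def)
    then have hG: "h \<in> carrier G" using HG by auto
    have "inv g \<otimes> x \<otimes> g = h"
      using g hG h(2) by (simp add: m_assoc cancel_inv)
    then show "x \<in> ?B" using h g hG by (simp add: topspace_eq)
  next
    fix x assume x: "x \<in> ?B"
    then have "x = g \<otimes> (inv g \<otimes> x \<otimes> g) \<otimes> inv g"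
      using g by (simp add: topspace_eq m_assoc cancel_inv)
    then show "x \<in> ?A" using x unfolding l_coset_def r_coset_def by blast
  qed
  have mult: "continuous_map T T (\<lambda>x. a x \<otimes> b x)"
    if "continuous_map T T a" "continuous_map T T b" for a b
    using continuous_map_compose[OF _ continuous_mult, of T "\<lambda>x. (a x, b x)"] that
    by (simp add: continuous_map_pairedI comp_def)
  have "continuous_map T T (\<lambda>x. inv g \<otimes> x \<otimes> g)"
    using g by (intro mult) (auto simp: topspace_eq)
  then have "closedin T ?B"
    using cl by (rule closedin_continuous_map_preimage)
  moreover have "subgroup ?B G"
  proof (rule subgroupI)
    show "?B \<subseteq> carrier G" by (auto simp: topspace_eq)
    show "?B \<noteq> {}" using g subgroup.one_closed[OF sub]
      by (auto simp: topspace_eq intro!: exI[of _ \<one>])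
  next
    fix a assume a: "a \<in> ?B"
    then have "inv (inv g \<otimes> a \<otimes> g) \<in> H" by (auto intro: subgroup.m_inv_closed[OF sub])
    then show "inv a \<in> ?B" using a g by (simp add: topspace_eq inv_mult_group m_assoc)
  next
    fix a b assume a: "a \<in> ?B" and b: "b \<in> ?B"
    then have "(inv g \<otimes> a \<otimes> g) \<otimes> (inv g \<otimes> b \<otimes> g) \<in> H"
      by (auto intro: subgroup.m_closed[OF sub])
    moreover have "(inv g \<otimes> a \<otimes> g) \<otimes> (inv g \<otimes> b \<otimes> g) = inv g \<otimes> (a \<otimes> b) \<otimes> g"
      using a b g by (simp add: topspace_eq m_assoc cancel_inv)
    ultimately show "a \<otimes> b \<in> ?B" using a b by (simp add: topspace_eq)
  qed
  ultimately show ?thesis unfolding eq by (simp add: closed_subgroups_def)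
qed

lemma l_coset_to_r_coset:
  assumes "g \<in> carrier G" "H \<subseteq> carrier G"
  shows "g <# H = (g <# H #> inv g) #> g"
  using assms by (simp add: coset_mult_assoc l_coset_subset_G)

lemma r_coset_to_l_coset:
  assumes "g \<in> carrier G" "H \<subseteq> carrier G"
  shows "H #> g = g <# (inv g <# H #> inv (inv g))"
proof -
  have "inv g <# H #> g = inv g <# (H #> g)"
    using assms by (simp add: coset_assoc)
  then show ?thesis using assms
    by (simp add: lcos_m_assoc r_coset_subset_G lcos_mult_one)
qed

lemma closed_cosets_eq_right:
  "closed_cosets G T = {H #> g |g H. g \<in> carrier G \<and> H \<in> closed_subgroups G T}"
proof (intro equalityI subsetI)
  fix C assume "C \<in> closed_cosets G T"
  then obtain g H where gH: "C = g <# H" "g \<in> carrier G" "H \<in> closed_subgroups G T"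
    by (auto simp: closed_cosets_def)
  then have "H \<subseteq> carrier G" by (auto simp: closed_subgroups_def dest: subgroup.subset)
  then show "C \<in> {H #> g |g H. g \<in> carrier G \<and> H \<in> closed_subgroups G T}"
    using gH l_coset_to_r_coset conjugate_closed_subgroup by blast
next
  fix C assume "C \<in> {H #> g |g H. g \<in> carrier G \<and> H \<in> closed_subgroups G T}"
  then obtain g H where gH: "C = H #> g" "g \<in> carrier G" "H \<in> closed_subgroups G T" by auto
  then have "H \<subseteq> carrier G" by (auto simp: closed_subgroups_def dest: subgroup.subset)
  then show "C \<in> closed_cosets G T"
    unfolding closed_cosets_def
    using gH r_coset_to_l_coset conjugate_closed_subgroup[of "inv g" H] by blast
qed

lemma closedin_closed_coset:
  assumes "C \<in> closed_cosets G T"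
  shows "closedin T C"
proof -
  obtain g H where gH: "C = g <# H" "g \<in> carrier G" and H: "subgroup H G" "closedin T H"
    using assms by (auto simp: closed_cosets_def closed_subgroups_def)
  have HG: "H \<subseteq> carrier G" by (rule subgroup.subset[OF H(1)])
  have "C = {x \<in> topspace T. inv g \<otimes> x \<in> H}" (is "_ = ?B")
  proof (intro equalityI subsetI)
    fix x assume "x \<in> C"
    then obtain h where h: "h \<in> H" "x = g \<otimes> h" by (auto simp: gH l_coset_def)
    then show "x \<in> ?B" using gH HG by (auto simp: topspace_eq cancel_inv subset_iff)
  next
    fix x assume x: "x \<in> ?B"
    then have "x = g \<otimes> (inv g \<otimes> x)" using gH by (simp add: topspace_eq cancel_inv)
    then show "x \<in> C" using x unfolding gH(1) l_coset_def by blast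
  qed
  moreover have "continuous_map T T (\<lambda>x. inv g \<otimes> x)"
    using continuous_map_compose[OF _ continuous_mult, of T "\<lambda>x. (inv g, x)"] gH(2)
    by (simp add: continuous_map_pairedI comp_def topspace_eq)
  ultimately show ?thesis using H(2) by (simp add: closedin_continuous_map_preimage)
qed

lemma topspace_Sub_space: "topspace (Sub_space G T) = closed_subgroups G T"
  by (auto simp: Sub_space_def topspace_fell closed_subgroups_def)

lemma topspace_Cos_space: "topspace (Cos_space G T) = closed_cosets G T"
  by (auto simp: Cos_space_def topspace_fell closedin_closed_coset)

lemma l_coset_group_unique:
  assumes "g \<in> carrier G" "g' \<in> carrier G" "subgroup H G" "subgroup H' G" "g <# H = g' <# H'"
  shows "H \<subseteq> H'"
proof
  fix h assume h: "h \<in> H"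
  have HG: "H \<subseteq> carrier G" "H' \<subseteq> carrier G" using assms subgroup.subset by auto
  have "g \<otimes> h \<in> g' <# H'" using h assms(5) by (auto simp: l_coset_def)
  then obtain b where b: "b \<in> H'" "g \<otimes> h = g' \<otimes> b" by (auto simp: l_coset_def)
  have "g \<otimes> \<one> \<in> g' <# H'" 
    using subgroup.one_closed[OF assms(3)] assms(5) unfolding l_coset_def by blast
  then obtain c where c: "c \<in> H'" "g = g' \<otimes> c" using assms(1) by (auto simp: l_coset_def)
  have "g' \<otimes> (c \<otimes> h) = g' \<otimes> b" using b c h assms HG by (simp add: m_assoc subset_iff)
  then have "c \<otimes> h = b" using b c h assms HG by (simp add: subset_iff)
  then have "h = inv c \<otimes> b" using b c h HG by (simp add: subset_iff inv_solve_left)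
  then show "h \<in> H'" using b c assms(4) by (simp add: subgroup.m_closed subgroup.m_inv_closed)
qed

lemma r_coset_group_unique:
  assumes "g \<in> carrier G" "g' \<in> carrier G" "subgroup H G" "subgroup H' G" "H #> g = H' #> g'"
  shows "H \<subseteq> H'"
proof
  fix h assume h: "h \<in> H"
  have HG: "H \<subseteq> carrier G" "H' \<subseteq> carrier G" using assms subgroup.subset by auto
  have "h \<otimes> g \<in> H' #> g'" using h assms(5) by (auto simp: r_coset_def)
  then obtain b where b: "b \<in> H'" "h \<otimes> g = b \<otimes> g'" by (auto simp: r_coset_def)
  have "\<one> \<otimes> g \<in> H' #> g'" 
    using subgroup.one_closed[OF assms(3)] assms(5) unfolding r_coset_def by blast
  then obtain c where c: "c \<in> H'" "g = c \<otimes> g'" using assms(1) by (auto simp: r_coset_def)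
  have "(h \<otimes> c) \<otimes> g' = b \<otimes> g'" using b c h assms HG by (simp add: m_assoc subset_iff)
  then have "h \<otimes> c = b" using b c h assms HG by (simp add: subset_iff)
  then have "h = b \<otimes> inv c" using b c h HG by (simp add: subset_iff inv_solve_right)
  then show "h \<in> H'" using b c assms(4) by (simp add: subgroup.m_closed subgroup.m_inv_closed)
qed

lemma pi_l_eq:
  assumes "g \<in> carrier G" "H \<in> closed_subgroups G T"
  shows "pi_l G T (g <# H) = H"
  unfolding pi_l_def using assms
  by (intro the_equality) (auto simp: closed_subgroups_def dest: l_coset_group_unique)

lemma pi_r_eq:
  assumes "g \<in> carrier G" "H \<in> closed_subgroups G T"
  shows "pi_r G T (H #> g) = H"
  unfolding pi_r_def using assms
  by (intro the_equality) (auto simp: closed_subgroups_def dest: r_coset_group_unique)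

lemma inv_l_coset_eq_image:
  assumes "g \<in> carrier G" "subgroup H G"
  shows "inv g <# H = m_inv G ` (H #> g)"
proof -
  have HG: "H \<subseteq> carrier G" using assms subgroup.subset by auto
  show ?thesis
  proof (intro equalityI subsetI)
    fix x assume "x \<in> inv g <# H"
    then obtain h where h: "h \<in> H" "x = inv g \<otimes> h" by (auto simp: l_coset_def)
    then have "x = inv (inv h \<otimes> g)" using HG assms by (simp add: inv_mult_group subset_iff)
    moreover have "inv h \<in> H" using h assms by (simp add: subgroup.m_inv_closed)
    ultimately show "x \<in> m_inv G ` (H #> g)" unfolding r_coset_def by blast
  next
    fix x assume "x \<in> m_inv G ` (H #> g)"
    then obtain h where h: "h \<in> H" "x = inv (h \<otimes> g)" by (auto simp: r_coset_def)
    then have "x = inv g \<otimes> inv h" using HG assms by (simp add: inv_mult_group subset_iff)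
    moreover have "inv h \<in> H" using h assms by (simp add: subgroup.m_inv_closed)
    ultimately show "x \<in> inv g <# H" unfolding l_coset_def by blast
  qed
qed

lemma coset_inversion_eq:
  assumes "g \<in> carrier G" "H \<in> closed_subgroups G T"
  shows "coset_inversion G T (H #> g) = inv g <# H"
  unfolding coset_inversion_def
proof (rule the_equality)
  show "\<exists>g'\<in>carrier G. \<exists>H'\<in>closed_subgroups G T. H #> g = H' #> g' \<and> inv g <# H = inv g' <# H'"
    using assms by blast
next
  fix D
  assume "\<exists>g'\<in>carrier G. \<exists>H'\<in>closed_subgroups G T. H #> g = H' #> g' \<and> D = inv g' <# H'"
  then show "D = inv g <# H"
    using assms by (auto simp: closed_subgroups_def inv_l_coset_eq_image)
qed

end

end

theory Submission
  imports Defs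
begin

text \<open>
  The involution \<open>\<rho>\<close> sends a coset \<open>C\<close> to the set \<open>C\<inverse>\<close> of inverses of its elements, so it
  interchanges the two translation actions, \<open>\<rho>(kC) = \<rho>(C)k\<inverse>\<close>, and the two projections,
  \<open>\<pi>\<^sub>l \<circ> \<rho> = \<pi>\<^sub>r\<close>. Consequently a left invariant measure with \<open>\<rho>\<^sub>*\<nu> = \<nu>\<close> is also right invariant.
  Conversely, if \<open>\<nu>\<close> is invariant on both sides then so is \<open>\<rho>\<^sub>*\<nu>\<close>, and the symmetrisation
  \<open>\<nu> + \<rho>\<^sub>*\<nu>\<close> is fixed by \<open>\<rho>\<close>. Its two projections are both \<open>\<pi>\<^sub>l\<^sub>*\<nu> + \<pi>\<^sub>r\<^sub>*\<nu>\<close>, which has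
  the null sets of \<open>\<lambda>\<close> because each summand has them.

  These push-forward computations need all the maps involved to be Borel. Translations
  and \<open>\<rho>\<close> are induced by homeomorphisms of the group (\<open>continuous_map_fell_image\<close>). For \<open>\<pi>\<^sub>l\<close>,
  local compactness enters through a tube argument (\<open>continuous_map_pi_l\<close>).
\<close>

section \<open>Sums of measures\<close>

definition add_measure :: "'x measure \<Rightarrow> 'x measure \<Rightarrow> 'x measure" where
  "add_measure M N = measure_of (space M) (sets M) (\<lambda>A. emeasure M A + emeasure N A)"

lemma sets_add_measure [simp]: "sets (add_measure M N) = sets M"
  and space_add_measure [simp]: "space (add_measure M N) = space M"
  by (simp_all add: add_measure_def)

lemma emeasure_add_measure:
  assumes "sets N = sets M" "A \<in> sets M"
  shows "emeasure (add_measure M N) A = emeasure M A + emeasure N A"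
  unfolding add_measure_def
proof (rule emeasure_measure_of_sigma[OF sets.sigma_algebra_axioms _ _ assms(2)])
  show "positive (sets M) (\<lambda>A. emeasure M A + emeasure N A)"
    by (simp add: positive_def)
  show "countably_additive (sets M) (\<lambda>A. emeasure M A + emeasure N A)"
    by (rule countably_additiveI)
      (use assms(1) in \<open>simp add: suminf_emeasure suminf_add[symmetric] image_subset_iff\<close>)
qed

lemma add_measure_commute:
  assumes "sets N = sets M"
  shows "add_measure M N = add_measure N M"
  using assms by (intro measure_eqI) (simp_all add: emeasure_add_measure add.commute)

lemma null_sets_add_measure:
  assumes "sets N = sets M"
  shows "null_sets (add_measure M N) = null_sets M \<inter> null_sets N"
  using assms by (auto simp: null_sets_def emeasure_add_measure)

lemma distr_add_measure:
  assumes "sets N = sets M" "f \<in> measurable M K" "sets K' = sets K"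
  shows "distr (add_measure M N) K' f = add_measure (distr M K f) (distr N K f)"
proof -
  have [measurable]: "f \<in> measurable N K" "f \<in> measurable (add_measure M N) K'"
    using assms by (simp_all cong: measurable_cong_sets)
  show ?thesis
    using assms sets_eq_imp_space_eq[OF assms(1)]
    by (intro measure_eqI)
      (auto simp: emeasure_distr emeasure_add_measure measurable_sets)
qed

text \<open>A sum of two \<open>\<sigma>\<close>-finite measures is \<open>\<sigma>\<close>-finite, as the pairwise intersections of the sets
  of two exhaustions have finite measure for both summands.\<close>

lemma sigma_finite_add_measure:
  assumes "sigma_finite_measure M" "sigma_finite_measure N" and sets: "sets N = sets M"
  shows "sigma_finite_measure (add_measure M N)"
proof -
  obtain A where A: "countable A" "A \<subseteq> sets M" "\<Union>A = space M" "\<And>a. a \<in> A \<Longrightarrow> emeasure M a \<noteq> \<infinity>"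
    using sigma_finite_measure.sigma_finite_countable[OF assms(1)] by blast
  obtain B where B: "countable B" "B \<subseteq> sets N" "\<Union>B = space N" "\<And>b. b \<in> B \<Longrightarrow> emeasure N b \<noteq> \<infinity>"
    using sigma_finite_measure.sigma_finite_countable[OF assms(2)] by blast
  let ?C = "(\<lambda>(a, b). a \<inter> b) ` (A \<times> B)"
  have "countable ?C"
    using A(1) B(1) by simp
  moreover have C_sets: "?C \<subseteq> sets M"
    using A(2) B(2) sets by auto
  moreover have "\<Union>?C = \<Union>A \<inter> \<Union>B"
    by blast
  then have "\<Union>?C = space M"
    using A(3) B(3) sets_eq_imp_space_eq[OF sets] by simp
  moreover have "emeasure (add_measure M N) c \<noteq> \<infinity>" if "c \<in> ?C" for c
  proof -
    obtain a b where c: "a \<in> A" "b \<in> B" "c = a \<inter> b"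
      using \<open>c \<in> ?C\<close> by auto
    have "emeasure M c \<le> emeasure M a" "emeasure N c \<le> emeasure N b"
      using c A(2) B(2) by (auto intro!: emeasure_mono)
    then have "emeasure M c < \<infinity>" "emeasure N c < \<infinity>"
      using A(4)[OF c(1)] B(4)[OF c(2)] by (auto simp: less_top[symmetric] top_unique)
    moreover have "c \<in> sets M"
      using that C_sets by blast
    ultimately show ?thesis
      by (auto simp: emeasure_add_measure sets)
  qed
  ultimately show ?thesis
    by (intro sigma_finite_measure.intro exI[of _ ?C]) simp
qed

section \<open>Borel maps between hyperspaces\<close>

lemma measurable_borel_of_continuous:
  assumes f: "continuous_map X Y f" and M: "sets M = sets (borel_of X)"
  shows "f \<in> measurable M (borel_of Y)"
  unfolding borel_of_def
proof (rule measurable_measure_of)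
  have opens: "{U. openin X U} \<subseteq> Pow (topspace X)"
    using openin_subset by blast
  have space: "space M = topspace X"
    using sets_eq_imp_space_eq[OF M] by (simp add: borel_of_def space_measure_of[OF opens])
  show "f \<in> space M \<rightarrow> topspace Y"
    using f by (simp add: space continuous_map_def)
  show "{U. openin Y U} \<subseteq> Pow (topspace Y)"
    using openin_subset by blast
  fix U assume "U \<in> {U. openin Y U}"
  then have "openin X {x \<in> topspace X. f x \<in> U}"
    using f by (simp add: continuous_map_def)
  then show "f -` U \<inter> space M \<in> sets M"
    unfolding M space by (auto simp: borel_of_def sets_measure_of[OF opens] vimage_def Int_def conj_commute)
qed

lemma openin_fell_miss:
  "compactin T K \<Longrightarrow> openin (fell_topology T) {C. closedin T C \<and> C \<inter> K = {}}"
  unfolding fell_topology_def by (rule topology_generated_by_Basis) blast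

lemma openin_fell_hit:
  "openin T U \<Longrightarrow> openin (fell_topology T) {C. closedin T C \<and> C \<inter> U \<noteq> {}}"
  unfolding fell_topology_def by (rule topology_generated_by_Basis) blast

lemma continuous_map_into_fell:
  assumes closed: "\<And>x. x \<in> topspace X \<Longrightarrow> closedin T (f x)"
    and miss: "\<And>K. compactin T K \<Longrightarrow> openin X {x \<in> topspace X. f x \<inter> K = {}}"
    and hit: "\<And>U. openin T U \<Longrightarrow> openin X {x \<in> topspace X. f x \<inter> U \<noteq> {}}"
  shows "continuous_map X (fell_topology T) f"
  unfolding fell_topology_def
proof (rule continuous_on_generated_topo)
  fix V
  assume "V \<in> {{C. closedin T C \<and> C \<inter> K = {}} |K. compactin T K} \<union>
    {{C. closedin T C \<and> C \<inter> U \<noteq> {}} |U. openin T U}"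
  then consider
    K where "compactin T K" "V = {C. closedin T C \<and> C \<inter> K = {}}"
    | U where "openin T U" "V = {C. closedin T C \<and> C \<inter> U \<noteq> {}}"
    by blast
  then show "openin X (f -` V \<inter> topspace X)"
  proof cases
    case 1
    then have "f -` V \<inter> topspace X = {x \<in> topspace X. f x \<inter> K = {}}"
      using closed by auto
    then show ?thesis using miss 1 by simp
  next
    case 2
    then have "f -` V \<inter> topspace X = {x \<in> topspace X. f x \<inter> U \<noteq> {}}"
      using closed by auto
    then show ?thesis using hit 2 by simp
  qed
next
  show "f ` topspace X \<subseteq> \<Union> ({{C. closedin T C \<and> C \<inter> K = {}} |K. compactin T K} \<union>
    {{C. closedin T C \<and> C \<inter> U \<noteq> {}} |U. openin T U})"
    using closed topspace_fell[of T] by (auto simp: fell_topology_def topology_generated_by_topspace)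
qed

text \<open>The image of \<open>C\<close> under a homeomorphism hits or misses a set iff \<open>C\<close> hits or misses its
  preimage, which is again open or compact.\<close>

lemma continuous_map_fell_image:
  assumes "homeomorphic_maps T T f g"
  shows "continuous_map (fell_topology T) (fell_topology T) ((`) f)"
proof (rule continuous_map_into_fell; unfold topspace_fell mem_Collect_eq)
  have fg: "homeomorphic_map T T f" "homeomorphic_map T T g"
    "\<And>x. x \<in> topspace T \<Longrightarrow> g (f x) = x" "\<And>x. x \<in> topspace T \<Longrightarrow> f (g x) = x"
    "continuous_map T T f" "continuous_map T T g"
    using assms homeomorphic_maps_map by (auto simp: homeomorphic_maps_def)
  show "closedin T (f ` C)" if "closedin T C" for C
    using homeomorphic_imp_closed_map[OF fg(1)] that by (simp add: closed_map_def)
  have int: "f ` C \<inter> A = {} \<longleftrightarrow> C \<inter> g ` A = {}" if "closedin T C" "A \<subseteq> topspace T" for C A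
  proof -
    have "C \<subseteq> topspace T" using that closedin_subset by auto
    then have "g (f x) = x" if "x \<in> C" for x
      using that by (intro fg(3)) blast
    moreover have "f (g y) = y" if "y \<in> A" for y
      using that \<open>A \<subseteq> topspace T\<close> by (intro fg(4)) blast
    ultimately show ?thesis
      by (force simp: disjoint_iff)
  qed
  show "openin (fell_topology T) {C. closedin T C \<and> f ` C \<inter> K = {}}" if "compactin T K" for K
  proof -
    have "{C. closedin T C \<and> f ` C \<inter> K = {}} = {C. closedin T C \<and> C \<inter> g ` K = {}}"
      using compactin_subset_topspace[OF that] by (intro Collect_cong) (simp add: int cong: conj_cong)
    then show ?thesis
      using openin_fell_miss[OF image_compactin[OF that fg(6)]] by simp
  qed
  show "openin (fell_topology T) {C. closedin T C \<and> f ` C \<inter> U \<noteq> {}}" if "openin T U" for U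
  proof -
    have "{C. closedin T C \<and> f ` C \<inter> U \<noteq> {}} = {C. closedin T C \<and> C \<inter> g ` U \<noteq> {}}"
      using openin_subset[OF that] by (intro Collect_cong) (simp add: int cong: conj_cong)
    moreover have "openin T (g ` U)"
      using homeomorphic_imp_open_map[OF fg(2)] that by (simp add: open_map_def)
    ultimately show ?thesis
      using openin_fell_hit by simp
  qed
qed

section \<open>Translations and inversion on the space of cosets\<close>

context topological_group
begin

lemma closed_subgroup_subset: "H \<in> closed_subgroups G T \<Longrightarrow> H \<subseteq> carrier G"
  by (auto simp: closed_subgroups_def dest: subgroup.subset)

lemma closed_coset_subset: "C \<in> closed_cosets G T \<Longrightarrow> C \<subseteq> carrier G"
  using closedin_subset[OF closedin_closed_coset] by (simp add: topspace_eq)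

lemma coset_inversion_eq_image:
  assumes "C \<in> closed_cosets G T"
  shows "coset_inversion G T C = m_inv G ` C"
proof -
  obtain g H where "g \<in> carrier G" "H \<in> closed_subgroups G T" "C = H #> g"
    using assms closed_cosets_eq_right by blast
  then show ?thesis
    using coset_inversion_eq inv_l_coset_eq_image by (simp add: closed_subgroups_def)
qed

lemma coset_inversion_closed:
  assumes "C \<in> closed_cosets G T"
  shows "coset_inversion G T C \<in> closed_cosets G T"
proof -
  obtain g H where "g \<in> carrier G" "H \<in> closed_subgroups G T" "C = H #> g"
    using assms closed_cosets_eq_right by blast
  then show ?thesis
    using coset_inversion_eq unfolding closed_cosets_def by auto
qed

lemma coset_inversion_involutive:
  assumes "C \<in> closed_cosets G T"
  shows "coset_inversion G T (coset_inversion G T C) = C"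
proof -
  have "\<And>x. x \<in> C \<Longrightarrow> inv (inv x) = x"
    using closed_coset_subset[OF assms] by auto
  then have "m_inv G ` m_inv G ` C = C"
    by (simp add: image_image)
  then show ?thesis
    using assms coset_inversion_closed by (metis coset_inversion_eq_image)
qed

lemma pi_l_coset_inversion:
  assumes "C \<in> closed_cosets G T"
  shows "pi_l G T (coset_inversion G T C) = pi_r G T C"
proof -
  obtain g H where "g \<in> carrier G" "H \<in> closed_subgroups G T" "C = H #> g"
    using assms closed_cosets_eq_right by blast
  then show ?thesis
    by (simp add: coset_inversion_eq pi_l_eq pi_r_eq)
qed

lemma pi_r_coset_inversion:
  assumes "C \<in> closed_cosets G T"
  shows "pi_r G T (coset_inversion G T C) = pi_l G T C"
  using pi_l_coset_inversion[OF coset_inversion_closed[OF assms]]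
  by (simp add: coset_inversion_involutive[OF assms])

lemma left_translate_closed:
  assumes "k \<in> carrier G" "C \<in> closed_cosets G T"
  shows "k <# C \<in> closed_cosets G T"
proof -
  obtain g H where "g \<in> carrier G" "H \<in> closed_subgroups G T" "C = g <# H"
    using assms(2) by (auto simp: closed_cosets_def)
  moreover from this have "k <# C = (k \<otimes> g) <# H"
    using assms(1) closed_subgroup_subset by (simp add: lcos_m_assoc)
  ultimately show ?thesis
    using assms(1) unfolding closed_cosets_def by blast
qed

lemma right_translate_closed:
  assumes "k \<in> carrier G" "C \<in> closed_cosets G T"
  shows "C #> k \<in> closed_cosets G T"
proof -
  obtain g H where "g \<in> carrier G" "H \<in> closed_subgroups G T" "C = H #> g"
    using assms(2) closed_cosets_eq_right by blast
  moreover from this have "C #> k = H #> (g \<otimes> k)"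
    using assms(1) closed_subgroup_subset by (simp add: coset_mult_assoc)
  ultimately show ?thesis
    using assms(1) unfolding closed_cosets_eq_right by blast
qed

lemma coset_inversion_left_translate:
  assumes "k \<in> carrier G" "C \<in> closed_cosets G T"
  shows "coset_inversion G T (k <# C) = coset_inversion G T C #> inv k"
proof -
  have "inv (k \<otimes> c) = inv c \<otimes> inv k" if "c \<in> C" for c
    using that assms closed_coset_subset inv_mult_group by blast
  then have "m_inv G ` (k <# C) = m_inv G ` C #> inv k"
    unfolding l_coset_def r_coset_def image_UN by auto
  then show ?thesis
    using assms by (simp add: coset_inversion_eq_image left_translate_closed)
qed

lemma coset_inversion_right_translate:
  assumes "k \<in> carrier G" "C \<in> closed_cosets G T"
  shows "coset_inversion G T (C #> k) = inv k <# coset_inversion G T C"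
proof -
  have "inv (c \<otimes> k) = inv k \<otimes> inv c" if "c \<in> C" for c
    using that assms closed_coset_subset inv_mult_group by blast
  then have "m_inv G ` (C #> k) = inv k <# m_inv G ` C"
    unfolding l_coset_def r_coset_def image_UN by auto
  then show ?thesis
    using assms by (simp add: coset_inversion_eq_image right_translate_closed)
qed

lemma continuous_map_mult:
  assumes "continuous_map X T a" "continuous_map X T b"
  shows "continuous_map X T (\<lambda>x. a x \<otimes> b x)"
  using continuous_map_compose[OF _ continuous_mult, of X "\<lambda>x. (a x, b x)"] assms
  by (simp add: continuous_map_pairedI comp_def)

lemma continuous_map_Cos_image:
  assumes "homeomorphic_maps T T f g"
    and "\<And>C. C \<in> closed_cosets G T \<Longrightarrow> h C = f ` C"
    and "\<And>C. C \<in> closed_cosets G T \<Longrightarrow> h C \<in> closed_cosets G T"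
  shows "continuous_map (Cos_space G T) (Cos_space G T) h"
proof -
  have "continuous_map (Cos_space G T) (fell_topology T) ((`) f)"
    unfolding Cos_space_def
    by (rule continuous_map_from_subtopology) (rule continuous_map_fell_image[OF assms(1)])
  then have "continuous_map (Cos_space G T) (fell_topology T) h"
    by (rule continuous_map_eq) (simp add: topspace_Cos_space assms(2))
  moreover have "h \<in> topspace (Cos_space G T) \<rightarrow> closed_cosets G T"
    by (simp add: topspace_Cos_space assms(3))
  ultimately have "continuous_map (Cos_space G T) (subtopology (fell_topology T) (closed_cosets G T)) h"
    by (rule continuous_map_into_subtopology)
  then show ?thesis
    by (simp add: Cos_space_def)
qed

lemma continuous_map_left_translate:
  assumes k: "k \<in> carrier G"
  shows "continuous_map (Cos_space G T) (Cos_space G T) (\<lambda>C. k <# C)"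
proof (rule continuous_map_Cos_image)
  show "homeomorphic_maps T T (\<lambda>x. k \<otimes> x) (\<lambda>x. inv k \<otimes> x)"
    using k unfolding homeomorphic_maps_def
    by (auto intro!: continuous_map_mult simp: topspace_eq cancel_inv)
qed (use k in \<open>auto simp: left_translate_closed, auto simp: l_coset_def\<close>)

lemma continuous_map_right_translate:
  assumes k: "k \<in> carrier G"
  shows "continuous_map (Cos_space G T) (Cos_space G T) (\<lambda>C. C #> k)"
proof (rule continuous_map_Cos_image)
  show "homeomorphic_maps T T (\<lambda>x. x \<otimes> k) (\<lambda>x. x \<otimes> inv k)"
    using k unfolding homeomorphic_maps_def
    by (auto intro!: continuous_map_mult simp: topspace_eq m_assoc)
qed (use k in \<open>auto simp: right_translate_closed, auto simp: r_coset_def\<close>)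

lemma continuous_map_coset_inversion:
  "continuous_map (Cos_space G T) (Cos_space G T) (coset_inversion G T)"
proof (rule continuous_map_Cos_image)
  show "homeomorphic_maps T T (m_inv G) (m_inv G)"
    by (rule homeomorphic_maps_involution) (auto simp: topspace_eq continuous_inv)
qed (erule coset_inversion_eq_image coset_inversion_closed)+

section \<open>Continuity of the projections\<close>

lemma pi_l_closed: "C \<in> closed_cosets G T \<Longrightarrow> pi_l G T C \<in> closed_subgroups G T"
  by (auto simp: closed_cosets_def pi_l_eq)

lemma mem_pi_l_iff:
  assumes C: "C \<in> closed_cosets G T" and c: "c \<in> C"
  shows "h \<in> pi_l G T C \<longleftrightarrow> h \<in> carrier G \<and> c \<otimes> h \<in> C"
proof -
  obtain g H where g: "g \<in> carrier G" and H: "H \<in> closed_subgroups G T" and C_eq: "C = g <# H"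
    using C by (auto simp: closed_cosets_def)
  have sub: "subgroup H G" and HG: "H \<subseteq> carrier G"
    using H closed_subgroup_subset by (auto simp: closed_subgroups_def)
  obtain a where a: "a \<in> H" "c = g \<otimes> a"
    using c by (auto simp: C_eq l_coset_def)
  have aG: "a \<in> carrier G" using a HG by auto
  have "h \<in> H \<longleftrightarrow> c \<otimes> h \<in> C" if h: "h \<in> carrier G"
  proof
    assume "h \<in> H"
    then have "a \<otimes> h \<in> H" using a sub by (simp add: subgroup.m_closed)
    moreover have "c \<otimes> h = g \<otimes> (a \<otimes> h)" using a aG g h by (simp add: m_assoc)
    ultimately show "c \<otimes> h \<in> C" unfolding C_eq l_coset_def by blast
  next
    assume "c \<otimes> h \<in> C"
    then obtain b where b: "b \<in> H" "c \<otimes> h = g \<otimes> b" by (auto simp: C_eq l_coset_def)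
    then have "g \<otimes> (a \<otimes> h) = g \<otimes> b" using a aG g h by (simp add: m_assoc)
    then have "a \<otimes> h = b" using aG g h b HG by (simp add: subset_iff)
    then have "h = inv a \<otimes> b" using aG h b HG by (simp add: subset_iff inv_solve_left)
    then show "h \<in> H" using a b sub by (simp add: subgroup.m_closed subgroup.m_inv_closed)
  qed
  then show ?thesis
    using g H HG by (auto simp: C_eq pi_l_eq)
qed

lemma closed_coset_nonempty: "C \<in> closed_cosets G T \<Longrightarrow> C \<noteq> {}"
  unfolding closed_cosets_def closed_subgroups_def l_coset_def
  by (auto dest: subgroup.one_closed)

lemma openin_Cos_miss:
  "compactin T K \<Longrightarrow> openin (Cos_space G T) {C \<in> closed_cosets G T. C \<inter> K = {}}"
  unfolding Cos_space_def openin_subtopology using closedin_closed_coset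
  by (intro exI[of _ "{C. closedin T C \<and> C \<inter> K = {}}"]) (auto simp: openin_fell_miss)

lemma openin_Cos_hit:
  "openin T U \<Longrightarrow> openin (Cos_space G T) {C \<in> closed_cosets G T. C \<inter> U \<noteq> {}}"
  unfolding Cos_space_def openin_subtopology using closedin_closed_coset
  by (intro exI[of _ "{C. closedin T C \<and> C \<inter> U \<noteq> {}}"]) (auto simp: openin_fell_hit)

text \<open>By \<open>\<pi>\<^sub>l(C) = C\<inverse>C\<close>, hitting an open set is witnessed by a pair of elements of \<open>C\<close>,
  both of which may be perturbed.\<close>

lemma openin_pi_l_hit:
  assumes U: "openin T U"
  shows "openin (Cos_space G T) {C \<in> closed_cosets G T. pi_l G T C \<inter> U \<noteq> {}}" (is "openin _ ?S")
proof (subst openin_subopen, intro ballI)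
  fix C assume "C \<in> ?S"
  then obtain h where C: "C \<in> closed_cosets G T" and h: "h \<in> pi_l G T C" "h \<in> U"
    by auto
  obtain c where c: "c \<in> C" using closed_coset_nonempty[OF C] by auto
  have cG: "c \<in> carrier G" using c C closed_coset_subset by auto
  have hG: "h \<in> carrier G" "c \<otimes> h \<in> C" using h mem_pi_l_iff[OF C c] by auto
  let ?W = "{p \<in> topspace (prod_topology T T). inv (fst p) \<otimes> snd p \<in> U}"
  have "continuous_map (prod_topology T T) T (\<lambda>p. inv (fst p) \<otimes> snd p)"
    using continuous_map_compose[OF continuous_map_fst continuous_inv, of T]
    by (intro continuous_map_mult continuous_map_snd) (simp add: comp_def)
  then have W: "openin (prod_topology T T) ?W"
    using U by (rule openin_continuous_map_preimage)
  have "(c, c \<otimes> h) \<in> ?W"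
    using cG hG h by (simp add: topspace_eq cancel_inv)
  then obtain A B where A: "openin T A" "c \<in> A" and B: "openin T B" "c \<otimes> h \<in> B" and AB: "A \<times> B \<subseteq> ?W"
    using W[unfolded openin_prod_topology_alt, rule_format] by blast
  let ?V = "{C \<in> closed_cosets G T. C \<inter> A \<noteq> {}} \<inter> {C \<in> closed_cosets G T. C \<inter> B \<noteq> {}}"
  have "D \<in> ?S" if D: "D \<in> ?V" for D
  proof -
    obtain a b where ab: "a \<in> D" "a \<in> A" "b \<in> D" "b \<in> B" using D by auto
    have "a \<in> carrier G" "b \<in> carrier G" using ab D closed_coset_subset by auto
    then have "inv a \<otimes> b \<in> pi_l G T D"
      using mem_pi_l_iff[of D a] ab D by (simp add: cancel_inv)
    moreover have "inv a \<otimes> b \<in> U" using AB ab by force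
    ultimately show ?thesis using D by auto
  qed
  moreover have "openin (Cos_space G T) ?V"
    using A B by (intro openin_Int openin_Cos_hit)
  moreover have "C \<in> ?V" using C c A B hG by auto
  ultimately show "\<exists>V. openin (Cos_space G T) V \<and> C \<in> V \<and> V \<subseteq> ?S" by blast
qed

text \<open>If \<open>c \<in> C\<close> then \<open>\<pi>\<^sub>l(C)\<close> misses \<open>K\<close> iff \<open>C\<close> misses \<open>cK\<close>. By the tube lemma and local
  compactness, \<open>C\<close> then misses the compact set \<open>VK\<close> for a compact neighbourhood \<open>V\<close> of \<open>c\<close>,
  and any coset that hits the interior of \<open>V\<close> and misses \<open>VK\<close> has a projection missing \<open>K\<close>.\<close>

lemma openin_pi_l_miss:
  assumes lc: "locally_compact_space T" and K: "compactin T K"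
  shows "openin (Cos_space G T) {C \<in> closed_cosets G T. pi_l G T C \<inter> K = {}}" (is "openin _ ?S")
proof (subst openin_subopen, intro ballI)
  fix C assume "C \<in> ?S"
  then have C: "C \<in> closed_cosets G T" and disj: "pi_l G T C \<inter> K = {}"
    by auto
  obtain c where c: "c \<in> C" using closed_coset_nonempty[OF C] by auto
  have cG: "c \<in> carrier G" using c C closed_coset_subset by auto
  have KG: "K \<subseteq> carrier G" using compactin_subset_topspace[OF K] topspace_eq by simp
  let ?m = "\<lambda>(x, y). x \<otimes> y"
  let ?W = "{p \<in> topspace (prod_topology T T). ?m p \<in> topspace T - C}"
  have "openin (prod_topology T T) ?W"
    using continuous_mult closedin_closed_coset[OF C]
    by (intro openin_continuous_map_preimage) auto
  moreover have "{c} \<times> K \<subseteq> ?W"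
    using disj mem_pi_l_iff[OF C c] cG KG by (auto simp: topspace_eq)
  ultimately have "\<exists>A B. openin T A \<and> openin T B \<and> c \<in> A \<and> K \<subseteq> B \<and> A \<times> B \<subseteq> ?W"
    using cG by (intro tube_lemma_right K) (simp_all add: topspace_eq)
  then obtain A B where A: "openin T A" "c \<in> A" and B: "K \<subseteq> B" and AB: "A \<times> B \<subseteq> ?W"
    by blast
  have "neighbourhood_base_of (compactin T) T"
    using locally_compact_space_neighbourhood_base Hausdorff lc by blast
  then obtain U V where U: "openin T U" "c \<in> U" "U \<subseteq> V" and V: "compactin T V" "V \<subseteq> A"
    using A unfolding neighbourhood_base_of by meson
  let ?VK = "?m ` (V \<times> K)"
  have VK: "compactin T ?VK"
    using V(1) K by (intro image_compactin[OF _ continuous_mult]) (simp add: compactin_Times)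
  let ?N = "{C \<in> closed_cosets G T. C \<inter> U \<noteq> {}} \<inter> {C \<in> closed_cosets G T. C \<inter> ?VK = {}}"
  have "D \<in> ?S" if D: "D \<in> ?N" for D
  proof -
    obtain d where d: "d \<in> D" "d \<in> U" using D by auto
    have "h \<notin> K" if "h \<in> pi_l G T D" for h
    proof
      assume "h \<in> K"
      then have "d \<otimes> h \<in> ?VK" using d U by force
      moreover have "d \<otimes> h \<in> D" using that mem_pi_l_iff[of D d] d D by auto
      ultimately show False using D by auto
    qed
    then show ?thesis using D by auto
  qed
  moreover have "openin (Cos_space G T) ?N"
    using U VK by (intro openin_Int openin_Cos_hit openin_Cos_miss)
  moreover have "C \<in> ?N" using C c U V AB B by fastforce
  ultimately show "\<exists>N. openin (Cos_space G T) N \<and> C \<in> N \<and> N \<subseteq> ?S" by blast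
qed

lemma continuous_map_pi_l:
  assumes "locally_compact_space T"
  shows "continuous_map (Cos_space G T) (Sub_space G T) (pi_l G T)"
proof -
  have "continuous_map (Cos_space G T) (fell_topology T) (pi_l G T)"
    using pi_l_closed openin_pi_l_hit openin_pi_l_miss[OF assms]
    by (intro continuous_map_into_fell) (auto simp: topspace_Cos_space closed_subgroups_def)
  moreover have "pi_l G T \<in> topspace (Cos_space G T) \<rightarrow> closed_subgroups G T"
    by (auto simp: topspace_Cos_space pi_l_closed)
  ultimately show ?thesis
    unfolding Sub_space_def by (simp add: continuous_map_into_subtopology)
qed

section \<open>Measures on the space of cosets\<close>

lemma space_borel_Cos:
  assumes "sets N = sets (borel_of (Cos_space G T))"
  shows "space N = closed_cosets G T"
proof -
  have "{U. openin (Cos_space G T) U} \<subseteq> Pow (topspace (Cos_space G T))"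
    using openin_subset by blast
  then show ?thesis
    using sets_eq_imp_space_eq[OF assms] by (simp add: borel_of_def space_measure_of topspace_Cos_space)
qed

lemma measurable_Cos_self:
  assumes f: "continuous_map (Cos_space G T) (Cos_space G T) f"
    and M: "sets M = sets (borel_of (Cos_space G T))" and N: "sets N = sets (borel_of (Cos_space G T))"
  shows "f \<in> measurable M N"
  using measurable_borel_of_continuous[OF f M] N by (simp cong: measurable_cong_sets)

lemma measurable_pi_l:
  assumes "locally_compact_space T" "sets N = sets (borel_of (Cos_space G T))"
  shows "pi_l G T \<in> measurable N (borel_of (Sub_space G T))"
  using continuous_map_pi_l[OF assms(1)] assms(2) by (rule measurable_borel_of_continuous)

lemma measurable_pi_r:
  assumes lc: "locally_compact_space T" and N: "sets N = sets (borel_of (Cos_space G T))"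
  shows "pi_r G T \<in> measurable N (borel_of (Sub_space G T))"
proof -
  have "(\<lambda>C. pi_l G T (coset_inversion G T C)) \<in> measurable N (borel_of (Sub_space G T))"
    using measurable_Cos_self[OF continuous_map_coset_inversion N N] measurable_pi_l[OF lc N]
    by (rule measurable_compose)
  then show ?thesis
    by (rule measurable_cong[THEN iffD1, rotated])
      (simp add: space_borel_Cos[OF N] pi_l_coset_inversion)
qed

text \<open>If \<open>\<rho>\<close> intertwines \<open>s\<close> with \<open>t\<close>, then it carries \<open>t\<close>-invariant measures to
  \<open>s\<close>-invariant ones.\<close>

lemma distr_inversion_invariant:
  assumes N: "sets N = sets (borel_of (Cos_space G T))"
    and s: "continuous_map (Cos_space G T) (Cos_space G T) s"
    and t: "continuous_map (Cos_space G T) (Cos_space G T) t"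
    and st: "\<And>C. C \<in> closed_cosets G T \<Longrightarrow> s (coset_inversion G T C) = coset_inversion G T (t C)"
    and inv: "distr N N t = N"
  defines "R \<equiv> distr N N (coset_inversion G T)"
  shows "distr R R s = R"
proof -
  note meas = measurable_Cos_self[OF _ N N]
  have "distr R R s = distr R N s"
    by (rule distr_cong) (simp_all add: R_def)
  also have "\<dots> = distr N N (s \<circ> coset_inversion G T)"
    unfolding R_def by (rule distr_distr[OF meas[OF s] meas[OF continuous_map_coset_inversion]])
  also have "\<dots> = distr N N (coset_inversion G T \<circ> t)"
    by (rule distr_cong) (simp_all add: space_borel_Cos[OF N] st)
  also have "\<dots> = distr (distr N N t) N (coset_inversion G T)"
    by (rule distr_distr[OF meas[OF continuous_map_coset_inversion] meas[OF t], symmetric])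
  finally show ?thesis by (simp add: inv R_def)
qed

lemma right_invariant_distr_inversion:
  assumes N: "sets N = sets (borel_of (Cos_space G T))" and inv: "left_invariant G N"
  shows "right_invariant G (distr N N (coset_inversion G T))"
  unfolding right_invariant_def
proof
  fix k assume k: "k \<in> carrier G"
  then show "distr (distr N N (coset_inversion G T)) (distr N N (coset_inversion G T)) (\<lambda>C. C #> k) =
      distr N N (coset_inversion G T)"
    using inv coset_inversion_left_translate[of "inv k"]
    by (intro distr_inversion_invariant[OF N, where t = "\<lambda>C. inv k <# C"]
        continuous_map_left_translate continuous_map_right_translate)
      (simp_all add: left_invariant_def)
qed

lemma left_invariant_distr_inversion:
  assumes N: "sets N = sets (borel_of (Cos_space G T))" and inv: "right_invariant G N"
  shows "left_invariant G (distr N N (coset_inversion G T))"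
  unfolding left_invariant_def
proof
  fix k assume k: "k \<in> carrier G"
  then show "distr (distr N N (coset_inversion G T)) (distr N N (coset_inversion G T)) (\<lambda>C. k <# C) =
      distr N N (coset_inversion G T)"
    using inv coset_inversion_right_translate[of "inv k"]
    by (intro distr_inversion_invariant[OF N, where t = "\<lambda>C. C #> inv k"]
        continuous_map_left_translate continuous_map_right_translate)
      (simp_all add: right_invariant_def)
qed

lemma left_invariant_add_measure:
  assumes M: "sets M = sets (borel_of (Cos_space G T))" and MN: "sets N = sets M"
    and inv: "left_invariant G M" "left_invariant G N"
  shows "left_invariant G (add_measure M N)"
  unfolding left_invariant_def
proof
  fix k assume k: "k \<in> carrier G"
  have "distr (add_measure M N) (add_measure M N) (\<lambda>C. k <# C) =
      add_measure (distr M M (\<lambda>C. k <# C)) (distr N M (\<lambda>C. k <# C))"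
    by (intro distr_add_measure MN measurable_Cos_self continuous_map_left_translate k M) simp
  also have "distr N M (\<lambda>C. k <# C) = distr N N (\<lambda>C. k <# C)"
    by (rule distr_cong) (simp_all add: MN)
  finally show "distr (add_measure M N) (add_measure M N) (\<lambda>C. k <# C) = add_measure M N"
    using inv k by (simp add: left_invariant_def)
qed

lemma distr_inversion_involutive:
  assumes N: "sets N = sets (borel_of (Cos_space G T))"
  shows "distr (distr N N (coset_inversion G T)) N (coset_inversion G T) = N"
proof -
  note meas = measurable_Cos_self[OF continuous_map_coset_inversion N N]
  have "distr (distr N N (coset_inversion G T)) N (coset_inversion G T)
      = distr N N (coset_inversion G T \<circ> coset_inversion G T)"
    by (rule distr_distr[OF meas meas])
  also have "\<dots> = distr N N (\<lambda>C. C)"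
    by (rule distr_cong) (simp_all add: space_borel_Cos[OF N] coset_inversion_involutive)
  finally show ?thesis by simp
qed

lemma sigma_finite_distr_inversion:
  assumes N: "sets N = sets (borel_of (Cos_space G T))" and "sigma_finite_measure N"
  shows "sigma_finite_measure (distr N N (coset_inversion G T))"
proof (rule sigma_finite_measure_distr)
  show "sigma_finite_measure (distr (distr N N (coset_inversion G T)) N (coset_inversion G T))"
    using assms by (simp add: distr_inversion_involutive)
  show "coset_inversion G T \<in> measurable (distr N N (coset_inversion G T)) N"
    using measurable_Cos_self[OF continuous_map_coset_inversion N N] by simp
qed

definition symmetrisation :: "'a set measure \<Rightarrow> 'a set measure" where
  "symmetrisation N = add_measure N (distr N N (coset_inversion G T))"

lemma sets_symmetrisation [simp]: "sets (symmetrisation N) = sets N"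
  by (simp add: symmetrisation_def)

lemma distr_inversion_symmetrisation:
  assumes N: "sets N = sets (borel_of (Cos_space G T))"
  shows "distr (symmetrisation N) (symmetrisation N) (coset_inversion G T) = symmetrisation N"
proof -
  have "distr (symmetrisation N) (symmetrisation N) (coset_inversion G T) =
      add_measure (distr N N (coset_inversion G T))
        (distr (distr N N (coset_inversion G T)) N (coset_inversion G T))"
    unfolding symmetrisation_def
    by (intro distr_add_measure measurable_Cos_self continuous_map_coset_inversion N) simp_all
  also have "\<dots> = add_measure (distr N N (coset_inversion G T)) N"
    by (simp only: distr_inversion_involutive[OF N])
  also have "\<dots> = symmetrisation N"
    unfolding symmetrisation_def by (rule add_measure_commute) simp
  finally show ?thesis .
qed

lemma distr_symmetrisation_pi:
  assumes lc: "locally_compact_space T" and N: "sets N = sets (borel_of (Cos_space G T))"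
  defines "B \<equiv> borel_of (Sub_space G T)"
  shows "distr (symmetrisation N) B (pi_l G T) =
      add_measure (distr N B (pi_l G T)) (distr N B (pi_r G T))"
    and "distr (symmetrisation N) B (pi_r G T) =
      add_measure (distr N B (pi_r G T)) (distr N B (pi_l G T))"
proof -
  note meas = measurable_pi_l[OF lc N, folded B_def] measurable_pi_r[OF lc N, folded B_def]
  note inv = measurable_Cos_self[OF continuous_map_coset_inversion N N]
  have l: "distr (distr N N (coset_inversion G T)) B (pi_l G T) = distr N B (pi_r G T)"
    unfolding distr_distr[OF meas(1) inv]
    by (rule distr_cong) (simp_all add: space_borel_Cos[OF N] pi_l_coset_inversion)
  have r: "distr (distr N N (coset_inversion G T)) B (pi_r G T) = distr N B (pi_l G T)"
    unfolding distr_distr[OF meas(2) inv]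
    by (rule distr_cong) (simp_all add: space_borel_Cos[OF N] pi_r_coset_inversion)
  show "distr (symmetrisation N) B (pi_l G T) =
      add_measure (distr N B (pi_l G T)) (distr N B (pi_r G T))"
    unfolding symmetrisation_def l[symmetric] by (rule distr_add_measure) (simp_all add: meas)
  show "distr (symmetrisation N) B (pi_r G T) =
      add_measure (distr N B (pi_r G T)) (distr N B (pi_l G T))"
    unfolding symmetrisation_def r[symmetric] by (rule distr_add_measure) (simp_all add: meas)
qed

lemma equivalent_distr_symmetrisation:
  assumes lc: "locally_compact_space T" and N: "sets N = sets (borel_of (Cos_space G T))"
  defines "B \<equiv> borel_of (Sub_space G T)"
  assumes l: "equivalent_measures (distr N B (pi_l G T)) (distr N B (pi_r G T))"
    and r: "equivalent_measures (distr N B (pi_r G T)) L"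
  shows "equivalent_measures (distr (symmetrisation N) B (pi_l G T)) L"
    and "equivalent_measures (distr (symmetrisation N) B (pi_r G T)) L"
proof -
  have sets: "sets B = sets L"
    and null: "null_sets (distr N B (pi_l G T)) = null_sets L"
      "null_sets (distr N B (pi_r G T)) = null_sets L"
    using l r by (simp_all add: equivalent_measures_def)
  show "equivalent_measures (distr (symmetrisation N) B (pi_l G T)) L"
    "equivalent_measures (distr (symmetrisation N) B (pi_r G T)) L"
    unfolding distr_symmetrisation_pi[OF lc N, folded B_def] equivalent_measures_def
    by (simp_all add: null_sets_add_measure null sets)
qed

end

theorem claim5p5:
  fixes G :: "('a, 'b) monoid_scheme" and T :: "'a topology" and L :: "'a set measure"
  assumes "topological_group G T"
    and "locally_compact_space T"
    and "second_countable T"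
    and "invariant_subgroup_measure G T L"
  shows
    "(\<exists>N :: 'a set measure.
        sigma_finite_borel_measure (Cos_space G T) N \<and>
        left_invariant G N \<and>
        equivalent_measures (distr N (borel_of (Sub_space G T)) (pi_l G T))
                            (distr N (borel_of (Sub_space G T)) (pi_r G T)) \<and>
        equivalent_measures (distr N (borel_of (Sub_space G T)) (pi_r G T)) L \<and>
        distr N N (coset_inversion G T) = N)
     \<longleftrightarrow>
     (\<exists>N :: 'a set measure.
        sigma_finite_borel_measure (Cos_space G T) N \<and>
        left_invariant G N \<and> right_invariant G N \<and>
        equivalent_measures (distr N (borel_of (Sub_space G T)) (pi_l G T))
                            (distr N (borel_of (Sub_space G T)) (pi_r G T)) \<and>
        equivalent_measures (distr N (borel_of (Sub_space G T)) (pi_r G T)) L)"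
    (is "?one \<longleftrightarrow> ?two")
proof -
  interpret topological_group G T by fact
  show ?thesis
  proof
    assume ?one
    then obtain N where N: "sigma_finite_borel_measure (Cos_space G T) N" "left_invariant G N"
      and pi: "equivalent_measures (distr N (borel_of (Sub_space G T)) (pi_l G T))
        (distr N (borel_of (Sub_space G T)) (pi_r G T))"
        "equivalent_measures (distr N (borel_of (Sub_space G T)) (pi_r G T)) L"
      and sym: "distr N N (coset_inversion G T) = N"
      by (elim exE conjE)
    have "right_invariant G (distr N N (coset_inversion G T))"
      using N by (intro right_invariant_distr_inversion) (simp_all add: sigma_finite_borel_measure_def)
    then show ?two
      using N pi unfolding sym by (intro exI[of _ N] conjI)
  next
    assume ?two
    then obtain N where sf: "sigma_finite_borel_measure (Cos_space G T) N"
      and inv: "left_invariant G N" "right_invariant G N"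
      and l: "equivalent_measures (distr N (borel_of (Sub_space G T)) (pi_l G T))
        (distr N (borel_of (Sub_space G T)) (pi_r G T))"
      and r: "equivalent_measures (distr N (borel_of (Sub_space G T)) (pi_r G T)) L"
      by (elim exE conjE)
    have N: "sets N = sets (borel_of (Cos_space G T))" "sigma_finite_measure N"
      using sf by (simp_all add: sigma_finite_borel_measure_def)
    have "sigma_finite_borel_measure (Cos_space G T) (symmetrisation N)"
      using N by (simp add: sigma_finite_borel_measure_def symmetrisation_def
          sigma_finite_add_measure sigma_finite_distr_inversion)
    moreover have "left_invariant G (symmetrisation N)"
      unfolding symmetrisation_def using N inv
      by (intro left_invariant_add_measure left_invariant_distr_inversion) simp_all
    moreover note equivalent_distr_symmetrisation[OF assms(2) N(1) l r]
    moreover note distr_inversion_symmetrisation[OF N(1)]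
    ultimately show ?one
      by (intro exI[of _ "symmetrisation N"]) (simp add: equivalent_measures_def)
  qed
qed

end
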